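(* Let $(X,\tau)$ be a topological space such that the family $\Phi$ of all neighborhood assignments $\phi:X\to\tau$ on $(X,\tau)$ is linearly ordered, and suppose there are topologies $\tau_1$ and $\tau_2$ on $X$ such that $\sup(\tau_1,\tau_2)=\tau$ and $(X,\tau_1,\tau_2)$ is a $p$-$D$-space. Then $(X,\tau)$ is a $D$-space.
   Context: A neighborhood assignment on $(X,\tau)$ is a function $\phi:X\to\tau$ with $x\in\phi(x)$ for all $x$. On the family $\Phi$ of all neighborhood assignments define the partial order $\phi_1\le\phi_2$ iff $\phi_1(x)\subseteq\phi_2(x)$ for each $x\in X$. This order is called linear if for each pair $\phi_1,\phi_2\in\Phi$ and each point $x\in X$ one has $\phi_1(x)\subseteq\phi_2(x)$ or $\phi_2(x)\subseteq\phi_1(x)$. $(X,\tau)$ is a $D$-space if for every neighborhood assignment $\phi$ on $X$ there is a closed discrete subset $D\subseteq X$ with $\bigcup_{x\in D}\phi(x)=X$. $\sup(\tau_1,\tau_2)$ is the topology generated by $\tau_1\cup\tau_2$. A bitopological space $(X,\tau_1,\tau_2)$ (a set with two topologies) is an $(i,j)$-$D$-space ($i,j\in\{1,2\}$, $i\ne j$) if for every $\phi_i:X\to\tau_i$ with $x\in\phi_i(x)$ for all $x$ there is a $\tau_j$-closed subset $D\subseteq X$, each of whose points is $\tau_i$-isolated in $D$, such that $\bigcup_{x\in D}\phi_i(x)=X$. It is a $p$-$D$-space if it is both a $(1,2)$-$D$-space and a $(2,1)$-$D$-space. *)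

theory Defs
  imports "HOL-Analysis.Analysis"
begin

(* The underlying set of a topology T is topspace T, which may be a proper subset of the type.
   No separation axiom is assumed. *)

(* Assignments are taken extensional, so that they are exactly the functions on topspace T. *)
definition nbhd_assignments :: "'a topology \<Rightarrow> ('a \<Rightarrow> 'a set) set" where
  "nbhd_assignments T =
     {\<phi> \<in> topspace T \<rightarrow>\<^sub>E {U. openin T U}. \<forall>x\<in>topspace T. x \<in> \<phi> x}"

(* Comparability is required point by point: which of the two inclusions holds may depend on x,
   so this does not literally ask for a total pointwise order on the assignments. *)
definition nbhd_assignments_linear :: "'a topology \<Rightarrow> bool" where
  "nbhd_assignments_linear T \<longleftrightarrow>
     (\<forall>\<phi>\<^sub>1\<in>nbhd_assignments T. \<forall>\<phi>\<^sub>2\<in>nbhd_assignments T. \<forall>x\<in>topspace T.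
        \<phi>\<^sub>1 x \<subseteq> \<phi>\<^sub>2 x \<or> \<phi>\<^sub>2 x \<subseteq> \<phi>\<^sub>1 x)"

definition D_space :: "'a topology \<Rightarrow> bool" where
  "D_space T \<longleftrightarrow>
     (\<forall>\<phi>\<in>nbhd_assignments T.
        \<exists>D. closedin T D \<and> subtopology T D = discrete_topology D \<and>
            (\<Union>x\<in>D. \<phi> x) = topspace T)"

definition sup_topology :: "'a topology \<Rightarrow> 'a topology \<Rightarrow> 'a topology" where
  "sup_topology T\<^sub>1 T\<^sub>2 = topology_generated_by ({U. openin T\<^sub>1 U} \<union> {U. openin T\<^sub>2 U})"

definition isolated_point_in :: "'a topology \<Rightarrow> 'a set \<Rightarrow> 'a \<Rightarrow> bool" where
  "isolated_point_in T D x \<longleftrightarrow> x \<in> D \<and> (\<exists>U. openin T U \<and> U \<inter> D = {x})"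

(* The (i,j)-D-property, with Ti and Tj passed in this order; meant for
   topspace Ti = topspace Tj. *)
definition bi_D_space :: "'a topology \<Rightarrow> 'a topology \<Rightarrow> bool" where
  "bi_D_space Ti Tj \<longleftrightarrow>
     (\<forall>\<phi>\<in>nbhd_assignments Ti.
        \<exists>D. closedin Tj D \<and> (\<forall>x\<in>D. isolated_point_in Ti D x) \<and>
            (\<Union>x\<in>D. \<phi> x) = topspace Ti)"

definition p_D_space :: "'a topology \<Rightarrow> 'a topology \<Rightarrow> bool" where
  "p_D_space T\<^sub>1 T\<^sub>2 \<longleftrightarrow> bi_D_space T\<^sub>1 T\<^sub>2 \<and> bi_D_space T\<^sub>2 T\<^sub>1"

end

theory Submission
  imports Defs
begin

text \<open>
  Linearity means that two open sets which meet are comparable. This leaves very little room: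
  if \<open>A\<close> and \<open>B\<close> are disjoint nonempty open sets, comparing \<open>W \<union> B\<close> with \<open>A\<close> shows that \<open>A\<close>
  is a minimal nonempty open set, and there are no three pairwise disjoint nonempty open sets.
  So the set \<open>D\<close> that the (1,2)-property gives for an assignment avoiding the whole space
  wherever possible has at most two points. If it has two, they make up the space, which is
  then discrete. If it is a single point \<open>x\<close>, then \<open>x\<close> is \<open>\<tau>\<^sub>2\<close>-closed and its only
  \<open>\<tau>\<^sub>1\<close>-neighbourhood is the whole space. Likewise there is a \<open>\<tau>\<^sub>1\<close>-closed point \<open>y\<close> whose
  only \<open>\<tau>\<^sub>2\<close>-neighbourhood is the whole space. The complement of \<open>x\<close> is \<open>\<tau>\<^sub>2\<close>-open, so
  \<open>x = y\<close>, and this point alone serves every assignment of the supremum topology.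
\<close>

text \<open>At a common point \<open>z\<close>, take two assignments with values \<open>U\<close>
  and \<open>V\<close> there and the whole space at every other point; linearity at \<open>z\<close>
  compares \<open>U\<close> with \<open>V\<close>.\<close>

lemma comparable_if_nbhd_assignments_linear:
  assumes "nbhd_assignments_linear T" and "openin T U" "openin T V" "U \<inter> V \<noteq> {}"
  shows "U \<subseteq> V \<or> V \<subseteq> U"
proof -
  obtain z where z: "z \<in> U" "z \<in> V" using assms(4) by blast
  define f where "f W = (\<lambda>x\<in>topspace T. if x = z then W else topspace T)" for W
  have zT: "z \<in> topspace T"
    using z assms openin_subset by blast
  have "f W \<in> nbhd_assignments T" if "openin T W" "z \<in> W" for W
    using that unfolding nbhd_assignments_def f_def by (auto simp: PiE_def)
  then have "f U z \<subseteq> f V z \<or> f V z \<subseteq> f U z"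
    using assms z zT unfolding nbhd_assignments_linear_def by blast
  then show ?thesis using zT by (simp add: f_def)
qed

lemma minimal_open_if_disjoint_open:
  assumes comp: "\<And>U V. openin T U \<Longrightarrow> openin T V \<Longrightarrow> U \<inter> V \<noteq> {} \<Longrightarrow> U \<subseteq> V \<or> V \<subseteq> U"
    and "openin T A" "openin T B" "A \<inter> B = {}" "B \<noteq> {}" "openin T W" "W \<inter> A \<noteq> {}"
  shows "A \<subseteq> W"
proof -
  have "W \<union> B \<subseteq> A \<or> A \<subseteq> W \<union> B"
    by (rule comp) (use assms in auto)
  then show ?thesis using assms by blast
qed

text \<open>The isolating sets may overlap outside \<open>D\<close>, but their traces on
  \<open>D\<close> suffice: \<open>U \<union> V\<close> and \<open>U \<union> W\<close> share
  \<open>x\<close>, while \<open>y\<close> lies only in the first and \<open>z\<close> only in the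
  second.\<close>

lemma no_three_isolated_points:
  assumes comp: "\<And>U V. openin T U \<Longrightarrow> openin T V \<Longrightarrow> U \<inter> V \<noteq> {} \<Longrightarrow> U \<subseteq> V \<or> V \<subseteq> U"
    and "isolated_point_in T D x" "isolated_point_in T D y" "isolated_point_in T D z"
    and "x \<noteq> y" "y \<noteq> z"
  shows "x = z"
proof (rule ccontr)
  assume "x \<noteq> z"
  obtain U V W where o: "openin T U" "openin T V" "openin T W"
    and i: "U \<inter> D = {x}" "V \<inter> D = {y}" "W \<inter> D = {z}"
    using assms(2-4) unfolding isolated_point_in_def by blast
  have "U \<union> V \<subseteq> U \<union> W \<or> U \<union> W \<subseteq> U \<union> V"
    by (rule comp) (use o i in auto)
  moreover have "y \<in> V - (U \<union> W)" "z \<in> W - (U \<union> V)"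
    using i \<open>x \<noteq> z\<close> assms(5,6) by auto
  ultimately show False by blast
qed

lemma D_space_discrete_topology: "D_space (discrete_topology S)"
proof -
  have "closedin (discrete_topology S) S \<and> subtopology (discrete_topology S) S = discrete_topology S
      \<and> (\<Union>x\<in>S. \<phi> x) = topspace (discrete_topology S)"
    if "\<phi> \<in> nbhd_assignments (discrete_topology S)" for \<phi>
  proof -
    have "\<phi> x \<subseteq> S" "x \<in> \<phi> x" if "x \<in> S" for x
      using \<open>\<phi> \<in> _\<close> that by (auto simp: nbhd_assignments_def PiE_def Pi_def)
    then have "(\<Union>x\<in>S. \<phi> x) = S" by blast
    then show ?thesis by (simp add: subtopology_eq_discrete_topology_eq)
  qed
  then show ?thesis unfolding D_space_def by blast
qed

lemma D_space_if_closed_point_with_single_nbhd: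
  assumes "closedin T {x}" and "\<And>U. openin T U \<Longrightarrow> x \<in> U \<Longrightarrow> U = topspace T"
  shows "D_space T"
  unfolding D_space_def
proof
  fix \<phi> assume phi: "\<phi> \<in> nbhd_assignments T"
  have x: "x \<in> topspace T" using assms(1) closedin_subset by fastforce
  then have "\<phi> x = topspace T"
    using phi assms(2) unfolding nbhd_assignments_def by (auto simp: PiE_def Pi_def)
  moreover have "subtopology T {x} = discrete_topology {x}"
    using x by (simp add: subtopology_eq_discrete_topology_sing)
  ultimately show "\<exists>D. closedin T D \<and> subtopology T D = discrete_topology D \<and>
      (\<Union>x\<in>D. \<phi> x) = topspace T"
    using assms(1) by (intro exI[of _ "{x}"]) simp
qed

lemma openin_sup_topology:
  "openin T\<^sub>1 U \<Longrightarrow> openin (sup_topology T\<^sub>1 T\<^sub>2) U"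
  "openin T\<^sub>2 U \<Longrightarrow> openin (sup_topology T\<^sub>1 T\<^sub>2) U"
  unfolding sup_topology_def by (simp_all add: topology_generated_by_Basis)

text \<open>Induction on the generation of \<open>U\<close>. The invariant also carries
  \<open>U \<subseteq> S\<close>, so that a union with one member equal to \<open>S\<close> is
  itself \<open>S\<close>.\<close>

lemma single_nbhd_sup_topology:
  assumes "openin (sup_topology T\<^sub>1 T\<^sub>2) U" "x \<in> U"
    and "topspace T\<^sub>1 = S" "topspace T\<^sub>2 = S"
    and "\<And>U. openin T\<^sub>1 U \<Longrightarrow> x \<in> U \<Longrightarrow> U = S" "\<And>U. openin T\<^sub>2 U \<Longrightarrow> x \<in> U \<Longrightarrow> U = S"
  shows "U = S"
proof -
  have "generate_topology_on ({U. openin T\<^sub>1 U} \<union> {U. openin T\<^sub>2 U}) U"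
    using assms(1) unfolding sup_topology_def by (simp add: openin_topology_generated_by_iff)
  then have "U \<subseteq> S \<and> (x \<in> U \<longrightarrow> U = S)"
  proof induction
    case (UN K)
    then show ?case by blast
  next
    case (Basis s)
    then have "openin T\<^sub>1 s \<or> openin T\<^sub>2 s" by blast
    then have "s \<subseteq> S" using openin_subset assms(3,4) by metis
    moreover have "s = S" if "x \<in> s"
      using \<open>openin T\<^sub>1 s \<or> _\<close> assms(5,6) that by blast
    ultimately show ?case by blast
  qed auto
  then show ?thesis using assms(2) by blast
qed

text \<open>\<open>T\<close> is only assumed finer than \<open>Ti\<close> and \<open>Tj\<close>,
  which lets the result be applied to both orders of the pair.\<close>

lemma bi_D_space_dichotomy:
  assumes comp: "\<And>U V. openin T U \<Longrightarrow> openin T V \<Longrightarrow> U \<inter> V \<noteq> {} \<Longrightarrow> U \<subseteq> V \<or> V \<subseteq> U"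
    and fine: "\<And>U. openin Ti U \<Longrightarrow> openin T U" "\<And>U. openin Tj U \<Longrightarrow> openin T U"
    and top: "topspace Ti = topspace T" "topspace Tj = topspace T"
    and bi: "bi_D_space Ti Tj"
  shows "T = discrete_topology (topspace T) \<or>
    (\<exists>x. closedin Tj {x} \<and> (\<forall>U. openin Ti U \<longrightarrow> x \<in> U \<longrightarrow> U = topspace T))"
proof (cases "topspace T = {}")
  case True
  then show ?thesis by (simp add: null_topspace_iff_trivial)
next
  case False
  define X where "X = topspace T"
  define P where "P x U \<longleftrightarrow> openin Ti U \<and> x \<in> U \<and> U \<noteq> X" for x U
  \<comment> \<open>A proper neighbourhood is chosen whenever one exists, so
    \<open>\<phi> x = X\<close> forces \<open>X\<close> to be the only
    \<open>Ti\<close>-neighbourhood of \<open>x\<close>.\<close>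
  define \<phi> where "\<phi> = (\<lambda>x\<in>X. if \<exists>U. P x U then SOME U. P x U else X)"
  have some: "P x (\<phi> x)" if "x \<in> X" "P x U" for x U
    using that someI[of "P x" U] unfolding \<phi>_def by auto
  have phi: "openin Ti (\<phi> x) \<and> x \<in> \<phi> x" if "x \<in> X" for x
  proof (cases "\<exists>U. P x U")
    case True
    then show ?thesis using some[OF that] unfolding P_def by blast
  next
    case False
    then have "\<phi> x = X" using that by (auto simp: \<phi>_def)
    moreover have "openin Ti X" using openin_topspace[of Ti] top X_def by simp
    ultimately show ?thesis using that by simp
  qed
  have full: "U = X" if "x \<in> X" "\<phi> x = X" "openin Ti U" "x \<in> U" for x U
    using some[of x U] that unfolding P_def by blast
  have "\<phi> \<in> nbhd_assignments Ti"
  proof -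
    have "\<phi> \<in> extensional X" by (simp add: \<phi>_def)
    then show ?thesis using phi top unfolding nbhd_assignments_def X_def by (auto simp: PiE_def)
  qed
  then obtain D where cl: "closedin Tj D" and iso: "\<forall>x\<in>D. isolated_point_in Ti D x"
    and cov: "(\<Union>x\<in>D. \<phi> x) = X"
    using bi unfolding bi_D_space_def top(1) X_def by blast
  have DX: "D \<subseteq> X" using closedin_subset[OF cl] top X_def by simp
  have isT: "isolated_point_in T D x" if "x \<in> D" for x
    using iso that fine unfolding isolated_point_in_def by blast
  show ?thesis
  proof (cases "\<exists>x\<in>D. \<phi> x = X")
    case True
    then obtain x where x: "x \<in> D" "\<phi> x = X" by blast
    have f: "U = X" if "openin Ti U" "x \<in> U" for U
      using full[of x U] x DX that by blast
    obtain U where U: "openin Ti U" "U \<inter> D = {x}"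
      using iso x unfolding isolated_point_in_def by blast
    \<comment> \<open>The set isolating \<open>x\<close> in \<open>D\<close> must be all of
      \<open>X\<close>, which leaves no other point in \<open>D\<close>.\<close>
    then have "U = X" using f[of U] by blast
    then have "D = {x}" using U DX by blast
    then show ?thesis using cl f X_def by blast
  next
    case no: False
    obtain x where x: "x \<in> D" using cov False X_def by blast
    have "D \<noteq> {x}" using cov no by auto
    then obtain y where y: "y \<in> D" "x \<noteq> y" using x by blast
    have D: "D = {x, y}"
    proof -
      have "z = x \<or> z = y" if "z \<in> D" for z
        using no_three_isolated_points[OF comp isT[OF x] isT[OF y(1)] isT[OF that]] y(2) by blast
      then show ?thesis using x y by blast
    qed
    define A B where "A = \<phi> x" and "B = \<phi> y"
    have A: "openin T A" "x \<in> A" "A \<noteq> X" and B: "openin T B" "y \<in> B" "B \<noteq> X"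
      using phi x y DX fine no unfolding A_def B_def by auto
    have AB: "A \<union> B = X" using cov D A_def B_def by auto
    \<comment> \<open>If \<open>A\<close> and \<open>B\<close> met, the larger of the two would be
      their union \<open>X\<close>, but both are proper.\<close>
    then have dj: "A \<inter> B = {}"
      using comp[OF A(1) B(1)] A(3) B(3) by blast
    have oD: "openin T (X - D)"
      using cl fine top unfolding closedin_def X_def by metis
    \<comment> \<open>Otherwise minimality of \<open>A\<close> would give
      \<open>A \<subseteq> X - D\<close>, although \<open>x\<close> lies in both \<open>A\<close>
      and \<open>D\<close>.\<close>
    have "(X - D) \<inter> A = {}"
      using minimal_open_if_disjoint_open[OF comp A(1) B(1) dj _ oD] A B D by blast
    moreover have "(X - D) \<inter> B = {}"
      using minimal_open_if_disjoint_open[OF comp B(1) A(1) _ _ oD] dj A B D by blast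
    ultimately have "X = {x, y}" using AB DX D by blast
    \<comment> \<open>Two disjoint open sets now split a two-point space, so both singletons are
      open.\<close>
    then have "A = {x}" "B = {y}" using A B dj AB by blast+
    then have "discrete_topology X = T"
      using A(1) B(1) \<open>X = {x, y}\<close> discrete_topology_unique[of X T] X_def by auto
    then show ?thesis using X_def by metis
  qed
qed

theorem theorem3p45:
  fixes \<tau> :: "'a topology"
  assumes "nbhd_assignments_linear \<tau>"
    and "\<exists>\<tau>\<^sub>1 \<tau>\<^sub>2. topspace \<tau>\<^sub>1 = topspace \<tau> \<and> topspace \<tau>\<^sub>2 = topspace \<tau> \<and>
           sup_topology \<tau>\<^sub>1 \<tau>\<^sub>2 = \<tau> \<and> p_D_space \<tau>\<^sub>1 \<tau>\<^sub>2"
  shows "D_space \<tau>"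
proof (cases "\<tau> = discrete_topology (topspace \<tau>)")
  case True
  then show ?thesis using D_space_discrete_topology by metis
next
  case False
  obtain \<tau>\<^sub>1 \<tau>\<^sub>2 where top: "topspace \<tau>\<^sub>1 = topspace \<tau>" "topspace \<tau>\<^sub>2 = topspace \<tau>"
    and sup: "sup_topology \<tau>\<^sub>1 \<tau>\<^sub>2 = \<tau>" and p: "p_D_space \<tau>\<^sub>1 \<tau>\<^sub>2"
    using assms(2) by blast
  note comp = comparable_if_nbhd_assignments_linear[OF assms(1)]
  note fine = openin_sup_topology[where T\<^sub>1 = \<tau>\<^sub>1 and T\<^sub>2 = \<tau>\<^sub>2, unfolded sup]
  obtain x where x: "closedin \<tau>\<^sub>2 {x}" "\<And>U. openin \<tau>\<^sub>1 U \<Longrightarrow> x \<in> U \<Longrightarrow> U = topspace \<tau>"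
    using bi_D_space_dichotomy[OF comp fine(1,2) top] p False unfolding p_D_space_def by blast
  obtain y where y: "closedin \<tau>\<^sub>1 {y}" "\<And>U. openin \<tau>\<^sub>2 U \<Longrightarrow> y \<in> U \<Longrightarrow> U = topspace \<tau>"
    using bi_D_space_dichotomy[OF comp fine(2,1) top(2,1)] p False unfolding p_D_space_def by blast
  have "y = x"
  proof (rule ccontr)
    assume "y \<noteq> x"
    moreover have "openin \<tau>\<^sub>2 (topspace \<tau> - {x})" "x \<in> topspace \<tau>" "y \<in> topspace \<tau>"
      using x(1) y(1) top unfolding closedin_def by auto
    ultimately show False using y(2)[of "topspace \<tau> - {x}"] by blast
  qed
  show ?thesis
  proof (rule D_space_if_closed_point_with_single_nbhd)
    show "closedin \<tau> {x}"
      using x(1) fine(2) top unfolding closedin_def by metis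
    show "U = topspace \<tau>" if "openin \<tau> U" "x \<in> U" for U
      using single_nbhd_sup_topology[of \<tau>\<^sub>1 \<tau>\<^sub>2 U x] that sup top x(2) y(2) \<open>y = x\<close> by metis
  qed
qed

end
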